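(* Let $G$ be a locally compact Hausdorff totally disconnected topological group, let $\mathcal{S}$ be a smooth representation of $G$ acting on the right, and let $V$ be a smooth representation of $G$ acting on the left. Then, as quotients of $\mathcal{S}\otimes_{\mathbb{C}}V$, there are equalities $$\mathcal{S}\otimes_{\mathcal{H}(G)}V=\mathcal{S}\otimes_G V=(\mathcal{S}\otimes V)_G.$$
   Context: $\mathcal{H}(G)$ is the Hecke algebra of locally constant compactly supported functions $G\to\mathbb{C}$ with product $(f_1*f_2)(g)=\int_G f_1(gh^{-1})f_2(h)\,dh$, where $dh$ is a fixed right Haar measure on $G$. A smooth left representation $V$ of $G$ is a left $\mathcal{H}(G)$-module via $fv=\int_G f(g)\,g.v\,dg$; a smooth right representation $\mathcal{S}$ is a right $\mathcal{H}(G)$-module via $sf=\int_G f(g)\,s.g\,dg$. The three quotients of $\mathcal{S}\otimes V=\mathcal{S}\otimes_{\mathbb{C}}V$ are defined as follows. - $\mathcal{S}\otimes_{\mathcal{H}(G)}V=(\mathcal{S}\otimes V)/N$, where $N$ is the span of all $sf\otimes v-s\otimes fv$ with $f\in\mathcal{H}(G)$, $s\in\mathcal{S}$, $v\in V$. - $\mathcal{S}\otimes_G V=(\mathcal{S}\otimes V)/N_1$, where $N_1$ is the span of all $s.g\otimes v-s\otimes g.v$ with $s\in\mathcal{S}$, $v\in V$, $g\in G$. - $(\mathcal{S}\otimes V)_G=(\mathcal{S}\otimes V)/N_2$, where $N_2$ is the span of all $s\otimes v-s.g^{-1}\otimes g.v$ with $s\in\mathcal{S}$, $v\in V$, $g\in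 G$. *)

theory Defs
  imports "HOL-Analysis.Analysis" "HOL-Algebra.Coset" "HOL-Library.Poly_Mapping"
begin

section \<open>Complex vector spaces\<close>

text \<open>
  A complex vector space is a type of class \<open>complex_vector\<close>.  The underlying real vector space
  is determined by restriction of scalars; it is part of the class so that notions that the
  library provides for \<open>real_vector\<close> can be used.
\<close>

class complex_vector = real_vector +
  fixes scaleC :: "complex \<Rightarrow> 'a \<Rightarrow> 'a"  (infixr \<open>*\<^sub>C\<close> 75)
  assumes scaleC_add_right: "a *\<^sub>C (x + y) = a *\<^sub>C x + a *\<^sub>C y"
    and scaleC_add_left: "(a + b) *\<^sub>C x = a *\<^sub>C x + b *\<^sub>C x"
    and scaleC_scaleC: "a *\<^sub>C b *\<^sub>C x = (a * b) *\<^sub>C x"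
    and scaleR_scaleC: "r *\<^sub>R x = complex_of_real r *\<^sub>C x"

global_interpretation complex_vector: vector_space "scaleC :: complex \<Rightarrow> 'a \<Rightarrow> 'a :: complex_vector"
  defines cspan = complex_vector.span
proof unfold_locales
  show "1 *\<^sub>C x = x" for x :: 'a
    using scaleR_scaleC[of 1 x] by simp
qed (rule scaleC_add_right scaleC_add_left scaleC_scaleC)+

abbreviation clinear :: "('a::complex_vector \<Rightarrow> 'b::complex_vector) \<Rightarrow> bool"
  where "clinear \<equiv> Vector_Spaces.linear scaleC scaleC"

text \<open>The quotient space by a linear subspace \<open>W\<close>, as the set of cosets of \<open>W\<close>.\<close>

definition vs_quotient :: "'a::complex_vector set \<Rightarrow> 'a set set"
  where "vs_quotient W = UNIV // {(x, y). x - y \<in> W}"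


section \<open>The tensor product over the complex numbers\<close>

text \<open>
  The tensor product is the free complex vector space on pairs, modulo the span of the
  bilinearity relations.
\<close>

instantiation complex :: complex_vector
begin

definition scaleC_complex :: "complex \<Rightarrow> complex \<Rightarrow> complex"
  where "scaleC_complex a x = a * x"

instance
  by standard (simp_all add: scaleC_complex_def algebra_simps scaleR_conv_of_real)

end

instantiation poly_mapping :: (type, complex_vector) complex_vector
begin

lift_definition scaleR_poly_mapping :: "real \<Rightarrow> ('a \<Rightarrow>\<^sub>0 'b) \<Rightarrow> ('a \<Rightarrow>\<^sub>0 'b)"
  is "\<lambda>r f k. r *\<^sub>R f k"
  by (rule finite_subset[rotated]) auto

lift_definition scaleC_poly_mapping :: "complex \<Rightarrow> ('a \<Rightarrow>\<^sub>0 'b) \<Rightarrow> ('a \<Rightarrow>\<^sub>0 'b)"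
  is "\<lambda>c f k. c *\<^sub>C f k"
  by (rule finite_subset[rotated]) auto

instance
  by (standard; transfer; simp add: fun_eq_iff scaleR_add_right scaleR_add_left
      scaleC_add_right scaleC_add_left scaleC_scaleC scaleR_scaleC)

end

definition bilinear_relations :: "('s::complex_vector \<times> 'v::complex_vector \<Rightarrow>\<^sub>0 complex) set"
  where "bilinear_relations =
    {Poly_Mapping.single (s + s', v) 1 - Poly_Mapping.single (s, v) 1 - Poly_Mapping.single (s', v) 1
      | s s' v. True} \<union>
    {Poly_Mapping.single (s, v + v') 1 - Poly_Mapping.single (s, v) 1 - Poly_Mapping.single (s, v') 1
      | s v v'. True} \<union>
    {Poly_Mapping.single (c *\<^sub>C s, v) 1 - c *\<^sub>C Poly_Mapping.single (s, v) 1 | c s v. True} \<union>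
    {Poly_Mapping.single (s, c *\<^sub>C v) 1 - c *\<^sub>C Poly_Mapping.single (s, v) 1 | c s v. True}"

definition tensor_rel ::
  "('s::complex_vector \<times> 'v::complex_vector \<Rightarrow>\<^sub>0 complex) \<Rightarrow> ('s \<times> 'v \<Rightarrow>\<^sub>0 complex) \<Rightarrow> bool"
  where "tensor_rel x y \<longleftrightarrow> x - y \<in> cspan bilinear_relations"

lemma equivp_tensor_rel:
  "equivp (tensor_rel :: ('s::complex_vector \<times> 'v::complex_vector \<Rightarrow>\<^sub>0 complex) \<Rightarrow> _)"
proof (intro equivpI reflpI sympI transpI)
  fix x y z :: "'s \<times> 'v \<Rightarrow>\<^sub>0 complex"
  show "tensor_rel x x"
    by (simp add: tensor_rel_def complex_vector.span_zero)
  show "tensor_rel y x" if "tensor_rel x y"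
    using complex_vector.span_neg[OF that[unfolded tensor_rel_def]] by (simp add: tensor_rel_def)
  show "tensor_rel x z" if "tensor_rel x y" "tensor_rel y z"
    using complex_vector.span_add[OF that[unfolded tensor_rel_def]] by (simp add: tensor_rel_def)
qed

quotient_type (overloaded) ('s, 'v) tensor =
  "'s::complex_vector \<times> 'v::complex_vector \<Rightarrow>\<^sub>0 complex" / tensor_rel
  by (rule equivp_tensor_rel)

instantiation tensor :: (complex_vector, complex_vector) complex_vector
begin

lift_definition zero_tensor :: "('a, 'b) tensor" is 0 .

lift_definition plus_tensor :: "('a, 'b) tensor \<Rightarrow> ('a, 'b) tensor \<Rightarrow> ('a, 'b) tensor"
  is "(+)"
  unfolding tensor_rel_def add_diff_add by (rule complex_vector.span_add)

lift_definition uminus_tensor :: "('a, 'b) tensor \<Rightarrow> ('a, 'b) tensor"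
  is uminus
  unfolding tensor_rel_def minus_diff_minus by (rule complex_vector.span_neg)

definition minus_tensor :: "('a, 'b) tensor \<Rightarrow> ('a, 'b) tensor \<Rightarrow> ('a, 'b) tensor"
  where "minus_tensor x y = x + - y"

lift_definition scaleC_tensor :: "complex \<Rightarrow> ('a, 'b) tensor \<Rightarrow> ('a, 'b) tensor"
  is scaleC
  unfolding tensor_rel_def complex_vector.scale_right_diff_distrib[symmetric]
  by (rule complex_vector.span_scale)

definition scaleR_tensor :: "real \<Rightarrow> ('a, 'b) tensor \<Rightarrow> ('a, 'b) tensor"
  where "scaleR_tensor r x = complex_of_real r *\<^sub>C x"

instance
proof
  fix x y z :: "('a, 'b) tensor" and r q :: real and a b :: complex
  have refl: "tensor_rel t t" for t :: "'a \<times> 'b \<Rightarrow>\<^sub>0 complex"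
    by (simp add: tensor_rel_def complex_vector.span_zero)
  show "x + y + z = x + (y + z)"
    by transfer (simp add: add.assoc refl)
  show "x + y = y + x"
    by transfer (simp add: add.commute refl)
  show "0 + x = x"
    by transfer (simp add: refl)
  show "- x + x = 0"
    by transfer (simp add: refl)
  show "x - y = x + - y"
    by (rule minus_tensor_def)
  show C1: "a *\<^sub>C (x + y) = a *\<^sub>C x + a *\<^sub>C y" for a and x y :: "('a, 'b) tensor"
    by transfer (simp add: complex_vector.scale_right_distrib refl)
  show C2: "(a + b) *\<^sub>C x = a *\<^sub>C x + b *\<^sub>C x" for a b and x :: "('a, 'b) tensor"
    by transfer (simp add: complex_vector.scale_left_distrib refl)
  show C3: "a *\<^sub>C b *\<^sub>C x = (a * b) *\<^sub>C x" for a b and x :: "('a, 'b) tensor"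
    by transfer (simp add: refl)
  show "r *\<^sub>R x = complex_of_real r *\<^sub>C x"
    by (rule scaleR_tensor_def)
  show "r *\<^sub>R (x + y) = r *\<^sub>R x + r *\<^sub>R y"
    by (simp add: scaleR_tensor_def C1)
  show "(r + q) *\<^sub>R x = r *\<^sub>R x + q *\<^sub>R x"
    by (simp add: scaleR_tensor_def C2)
  show "r *\<^sub>R q *\<^sub>R x = (r * q) *\<^sub>R x"
    by (simp add: scaleR_tensor_def C3)
  show "1 *\<^sub>R x = x"
    unfolding scaleR_tensor_def of_real_1 by transfer (simp add: refl)
qed

end

lift_definition tensor_of :: "'s::complex_vector \<Rightarrow> 'v::complex_vector \<Rightarrow> ('s, 'v) tensor"
    (infixr \<open>\<otimes>\<^sub>C\<close> 70)
  is "\<lambda>s v. Poly_Mapping.single (s, v) 1" .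

lemma tensor_of_add_left: "(s + s') \<otimes>\<^sub>C v = s \<otimes>\<^sub>C v + s' \<otimes>\<^sub>C v"
  by (transfer, unfold tensor_rel_def diff_diff_eq[symmetric],
      rule complex_vector.span_base, unfold bilinear_relations_def, blast)

lemma tensor_of_add_right: "s \<otimes>\<^sub>C (v + v') = s \<otimes>\<^sub>C v + s \<otimes>\<^sub>C v'"
  by (transfer, unfold tensor_rel_def diff_diff_eq[symmetric],
      rule complex_vector.span_base, unfold bilinear_relations_def, blast)

lemma tensor_of_scaleC_left: "(c *\<^sub>C s) \<otimes>\<^sub>C v = c *\<^sub>C (s \<otimes>\<^sub>C v)"
  by (transfer, unfold tensor_rel_def,
      rule complex_vector.span_base, unfold bilinear_relations_def, blast)

lemma tensor_of_scaleC_right: "s \<otimes>\<^sub>C (c *\<^sub>C v) = c *\<^sub>C (s \<otimes>\<^sub>C v)"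
  by (transfer, unfold tensor_rel_def,
      rule complex_vector.span_base, unfold bilinear_relations_def, blast)


section \<open>Locally compact totally disconnected groups and Haar measure\<close>

locale lctd_group = group G for G (structure) +
  fixes T :: "'g topology"
  assumes topspace_eq: "topspace T = carrier G"
    and continuous_mult: "continuous_map (prod_topology T T) T (\<lambda>(g, h). g \<otimes> h)"
    and continuous_inv: "continuous_map T T (\<lambda>g. inv g)"
    and hausdorff: "Hausdorff_space T"
    and locally_compact: "locally_compact_space T"
    and totally_disconnected: "connectedin T C \<Longrightarrow> \<exists>g. C \<subseteq> {g}"

text \<open>A right Haar measure is a nonzero right-invariant Radon measure on the Borel sets.\<close>

definition right_haar_measure ::
  "('g, 'b) monoid_scheme \<Rightarrow> 'g topology \<Rightarrow> 'g measure \<Rightarrow> bool"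
  where "right_haar_measure G T M \<longleftrightarrow>
    space M = carrier G \<and>
    sets M = sigma_sets (carrier G) {U. openin T U} \<and>
    (\<forall>A \<in> sets M. \<forall>g \<in> carrier G. emeasure M (A #>\<^bsub>G\<^esub> g) = emeasure M A) \<and>
    (\<forall>K. compactin T K \<longrightarrow> emeasure M K < \<infinity>) \<and>
    (\<forall>A \<in> sets M. emeasure M A = (INF U \<in> {U. openin T U \<and> A \<subseteq> U}. emeasure M U)) \<and>
    (\<forall>U. openin T U \<longrightarrow> emeasure M U = (SUP K \<in> {K. compactin T K \<and> K \<subseteq> U}. emeasure M K)) \<and>
    emeasure M (carrier G) \<noteq> 0"


section \<open>The Hecke algebra\<close>

text \<open>Functions on \<open>G\<close> are represented by functions on the type that vanish off the carrier.\<close>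

definition hecke_algebra ::
  "('g, 'b) monoid_scheme \<Rightarrow> 'g topology \<Rightarrow> ('g \<Rightarrow> complex) set"
  where "hecke_algebra G T = {f.
    (\<forall>g. g \<notin> carrier G \<longrightarrow> f g = 0) \<and>
    (\<forall>g \<in> carrier G. \<exists>U. openin T U \<and> g \<in> U \<and> (\<forall>h \<in> U. f h = f g)) \<and>
    compactin T (T closure_of {g \<in> carrier G. f g \<noteq> 0})}"

text \<open>
  The convolution product of the Hecke algebra.  The spans defining the three quotients below
  involve only the action of Hecke functions on representations, not this product.
\<close>

definition hecke_mult ::
  "('g, 'b) monoid_scheme \<Rightarrow> 'g measure \<Rightarrow> ('g \<Rightarrow> complex) \<Rightarrow> ('g \<Rightarrow> complex) \<Rightarrow> 'g \<Rightarrow> complex"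
  where "hecke_mult G M f\<^sub>1 f\<^sub>2 =
    (\<lambda>g. if g \<in> carrier G then \<integral>h. f\<^sub>1 (g \<otimes>\<^bsub>G\<^esub> inv\<^bsub>G\<^esub> h) * f\<^sub>2 h \<partial>M else 0)"


section \<open>Smooth representations\<close>

definition smooth_left_rep ::
  "('g, 'b) monoid_scheme \<Rightarrow> 'g topology \<Rightarrow> ('g \<Rightarrow> 'v::complex_vector \<Rightarrow> 'v) \<Rightarrow> bool"
  where "smooth_left_rep G T \<rho> \<longleftrightarrow>
    (\<forall>g \<in> carrier G. clinear (\<rho> g)) \<and>
    (\<forall>v. \<rho> \<one>\<^bsub>G\<^esub> v = v) \<and>
    (\<forall>g \<in> carrier G. \<forall>h \<in> carrier G. \<forall>v. \<rho> (g \<otimes>\<^bsub>G\<^esub> h) v = \<rho> g (\<rho> h v)) \<and>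
    (\<forall>v. openin T {g \<in> carrier G. \<rho> g v = v})"

definition smooth_right_rep ::
  "('g, 'b) monoid_scheme \<Rightarrow> 'g topology \<Rightarrow> ('s::complex_vector \<Rightarrow> 'g \<Rightarrow> 's) \<Rightarrow> bool"
  where "smooth_right_rep G T \<sigma> \<longleftrightarrow>
    (\<forall>g \<in> carrier G. clinear (\<lambda>s. \<sigma> s g)) \<and>
    (\<forall>s. \<sigma> s \<one>\<^bsub>G\<^esub> = s) \<and>
    (\<forall>g \<in> carrier G. \<forall>h \<in> carrier G. \<forall>s. \<sigma> s (g \<otimes>\<^bsub>G\<^esub> h) = \<sigma> (\<sigma> s g) h) \<and>
    (\<forall>s. openin T {g \<in> carrier G. \<sigma> s g = s})"

text \<open>
  For a Hecke function \<open>f\<close> and a vector \<open>v\<close> of a smooth representation, the integrand below is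
  locally constant with compact support, so it takes finitely many values and each nonzero value
  is attained on a compact open set.  Its integral is therefore the finite sum
  \<open>simple_bochner_integral\<close>; no topology on the representation space is involved.
\<close>

definition hecke_act_left ::
  "'g measure \<Rightarrow> ('g \<Rightarrow> 'v::complex_vector \<Rightarrow> 'v) \<Rightarrow> ('g \<Rightarrow> complex) \<Rightarrow> 'v \<Rightarrow> 'v"
  where "hecke_act_left M \<rho> f v =
    Bochner_Integration.simple_bochner_integral M (\<lambda>g. f g *\<^sub>C \<rho> g v)"

definition hecke_act_right ::
  "'g measure \<Rightarrow> ('s::complex_vector \<Rightarrow> 'g \<Rightarrow> 's) \<Rightarrow> 's \<Rightarrow> ('g \<Rightarrow> complex) \<Rightarrow> 's"
  where "hecke_act_right M \<sigma> s f =
    Bochner_Integration.simple_bochner_integral M (\<lambda>g. f g *\<^sub>C \<sigma> s g)"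


section \<open>The three quotients of the tensor product\<close>

definition hecke_tensor ::
  "('g, 'b) monoid_scheme \<Rightarrow> 'g topology \<Rightarrow> 'g measure \<Rightarrow>
   ('s::complex_vector \<Rightarrow> 'g \<Rightarrow> 's) \<Rightarrow> ('g \<Rightarrow> 'v::complex_vector \<Rightarrow> 'v) \<Rightarrow> ('s, 'v) tensor set set"
  where "hecke_tensor G T M \<sigma> \<rho> = vs_quotient (cspan
    {hecke_act_right M \<sigma> s f \<otimes>\<^sub>C v - s \<otimes>\<^sub>C hecke_act_left M \<rho> f v
      | s f v. f \<in> hecke_algebra G T})"

definition group_tensor ::
  "('g, 'b) monoid_scheme \<Rightarrow>
   ('s::complex_vector \<Rightarrow> 'g \<Rightarrow> 's) \<Rightarrow> ('g \<Rightarrow> 'v::complex_vector \<Rightarrow> 'v) \<Rightarrow> ('s, 'v) tensor set set"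
  where "group_tensor G \<sigma> \<rho> = vs_quotient (cspan
    {\<sigma> s g \<otimes>\<^sub>C v - s \<otimes>\<^sub>C \<rho> g v | s g v. g \<in> carrier G})"

definition tensor_coinvariants ::
  "('g, 'b) monoid_scheme \<Rightarrow>
   ('s::complex_vector \<Rightarrow> 'g \<Rightarrow> 's) \<Rightarrow> ('g \<Rightarrow> 'v::complex_vector \<Rightarrow> 'v) \<Rightarrow> ('s, 'v) tensor set set"
  where "tensor_coinvariants G \<sigma> \<rho> = vs_quotient (cspan
    {s \<otimes>\<^sub>C v - \<sigma> s (inv\<^bsub>G\<^esub> g) \<otimes>\<^sub>C \<rho> g v | s g v. g \<in> carrier G})"

end

theory Submission
  imports Defs
begin

text \<open>
  Write \<open>N\<close>, \<open>N\<^sub>1\<close>, \<open>N\<^sub>2\<close> for the three subspaces of \<open>S \<otimes> V\<close> that are divided out.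

  \<open>N \<subseteq> N\<^sub>1\<close> (\<open>hecke_relation_in_group_span\<close>): the map \<open>g
  \<mapsto> f g (s.g \<otimes> v - s \<otimes> g.v)\<close> is a finitely valued function with values in
  \<open>N\<^sub>1\<close>, and its integral, a finite linear combination of its values, is \<open>sf
  \<otimes> v - s \<otimes> fv\<close> because the integral commutes with the linear maps \<open>- \<otimes>
  v\<close> and \<open>s \<otimes> -\<close>.

  \<open>N\<^sub>1 \<subseteq> N\<close> (\<open>group_relation_in_hecke_span\<close>): by smoothness the
  maps \<open>h \<mapsto> s.h\<close> and \<open>h \<mapsto> h.v\<close> are locally constant, so for given
  \<open>g\<close> they are constant on a neighbourhood of \<open>g\<close>.  Since \<open>G\<close> is
  locally compact and totally disconnected, this neighbourhood contains a compact open set \<open>C\<close>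
  with \<open>g \<in> C\<close> (\<open>compact_open_neighbourhood\<close>).  With the indicator function
  \<open>f\<close> of \<open>C\<close> one gets \<open>sf = \<mu>(C) s.g\<close> and \<open>fv = \<mu>(C)
  g.v\<close>, and \<open>0 < \<mu>(C) < \<infinity>\<close> (\<open>haar_measure_compact_open_pos\<close>),
  so \<open>s.g \<otimes> v - s \<otimes> g.v\<close> is a multiple of \<open>sf \<otimes> v - s \<otimes>
  fv\<close>.

  \<open>N\<^sub>1 = N\<^sub>2\<close>: the substitution \<open>s \<mapsto> s.g\<close> carries one generating set to the other.

  A map is locally constant if and only if it is continuous for the discrete topology on its
  codomain; this is how local constancy is expressed below.
\<close>


section \<open>Compact open neighbourhoods\<close>

text \<open>
  The connected component of \<open>x\<close> is \<open>{x}\<close>, which is compact, and in a locally compact Hausdorff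
  space a compact component has arbitrarily small clopen neighbourhoods.
\<close>

lemma compact_open_neighbourhood:
  assumes "locally_compact_space X" "Hausdorff_space X"
    and disconnected: "\<And>C. connectedin X C \<Longrightarrow> \<exists>x. C \<subseteq> {x}"
    and "openin X W" "x \<in> W"
  obtains C where "openin X C" "compactin X C" "x \<in> C" "C \<subseteq> W"
proof -
  have x: "x \<in> topspace X"
    using assms(4,5) openin_subset by blast
  obtain N L where NL: "openin X N" "compactin X L" "x \<in> N" "N \<subseteq> L"
    using assms(1) x unfolding locally_compact_space_def by metis
  have comp: "connected_component_of_set X x = {x}"
  proof -
    obtain y where "connected_component_of_set X x \<subseteq> {y}"
      using disconnected[OF connectedin_connected_component_of] by blast
    moreover have "x \<in> connected_component_of_set X x"
      using x by (simp add: connected_component_of_refl)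
    ultimately show ?thesis
      by blast
  qed
  have "{x} \<in> connected_components_of X"
    using x comp connected_component_in_connected_components_of by metis
  moreover have "compactin X {x}" "openin X (W \<inter> N)" "{x} \<subseteq> W \<inter> N"
    using x assms(4,5) NL by auto
  ultimately obtain U V where UV: "openin X U" "openin X V" "disjnt U V" "U \<union> V = topspace X"
      "{x} \<subseteq> U" "U \<subseteq> W \<inter> N"
    using wilder_locally_compact_component_thm[OF assms(1,2)] by metis
  have "U = topspace X - V"
    using UV by (auto simp: disjnt_iff)
  then have "closedin X U"
    using UV(2) by blast
  then have "compactin X U"
    using closed_compactin[OF NL(2)] UV(6) NL(4) by blast
  then show thesis
    using that UV by auto
qed


section \<open>Haar measure of compact open sets\<close>

context lctd_group
begin

lemma continuous_map_right_translation:
  assumes "g \<in> carrier G"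
  shows "continuous_map T T (\<lambda>h. h \<otimes> g)"
proof -
  have "continuous_map T (prod_topology T T) (\<lambda>h. (h, g))"
    using assms by (intro continuous_map_pairedI) (auto simp: topspace_eq)
  from continuous_map_compose[OF this continuous_mult] show ?thesis
    by (simp add: comp_def)
qed

lemma openin_r_coset:
  assumes "openin T A" "g \<in> carrier G"
  shows "openin T (A #> g)"
proof -
  have A: "A \<subseteq> carrier G"
    using assms(1) openin_subset topspace_eq by metis
  have "A #> g = {h \<in> topspace T. h \<otimes> inv g \<in> A}"
  proof (intro equalityI subsetI)
    fix h assume "h \<in> A #> g"
    then show "h \<in> {h \<in> topspace T. h \<otimes> inv g \<in> A}"
      using A assms(2) by (auto simp: r_coset_def topspace_eq m_assoc subset_iff)
  next
    fix h assume "h \<in> {h \<in> topspace T. h \<otimes> inv g \<in> A}"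
    then have "h \<otimes> inv g \<in> A" "(h \<otimes> inv g) \<otimes> g = h"
      using assms(2) by (auto simp: topspace_eq m_assoc)
    then show "h \<in> A #> g"
      by (auto simp: r_coset_def intro!: bexI[of _ "h \<otimes> inv g"])
  qed
  also have "openin T \<dots>"
    using openin_continuous_map_preimage[OF continuous_map_right_translation assms(1)] assms(2)
    by simp
  finally show ?thesis .
qed

text \<open>
  The clauses are separated once and for all because outer regularity, taken as a rewrite rule,
  replaces a measure by an infimum of measures and applies again to these.
\<close>

lemma right_haar_measureD:
  assumes "right_haar_measure G T M"
  shows "space M = carrier G"
    and "sets M = sigma_sets (carrier G) {U. openin T U}"
    and "A \<in> sets M \<Longrightarrow> g \<in> carrier G \<Longrightarrow> emeasure M (A #> g) = emeasure M A"
    and "compactin T K \<Longrightarrow> emeasure M K < \<infinity>"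
    and "openin T U \<Longrightarrow> emeasure M U = (SUP K \<in> {K. compactin T K \<and> K \<subseteq> U}. emeasure M K)"
    and "emeasure M (carrier G) \<noteq> 0"
proof -
  note h = assms[unfolded right_haar_measure_def]
  show "space M = carrier G"
    by (rule h[THEN conjunct1])
  show "sets M = sigma_sets (carrier G) {U. openin T U}"
    by (rule h[THEN conjunct2, THEN conjunct1])
  show "A \<in> sets M \<Longrightarrow> g \<in> carrier G \<Longrightarrow> emeasure M (A #> g) = emeasure M A"
    by (rule h[THEN conjunct2, THEN conjunct2, THEN conjunct1, rule_format])
  show "compactin T K \<Longrightarrow> emeasure M K < \<infinity>"
    by (rule h[THEN conjunct2, THEN conjunct2, THEN conjunct2, THEN conjunct1, rule_format])
  note h' = h[THEN conjunct2, THEN conjunct2, THEN conjunct2, THEN conjunct2, THEN conjunct2]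
  show "openin T U \<Longrightarrow> emeasure M U = (SUP K \<in> {K. compactin T K \<and> K \<subseteq> U}. emeasure M K)"
    by (rule h'[THEN conjunct1, rule_format])
  show "emeasure M (carrier G) \<noteq> 0"
    by (rule h'[THEN conjunct2])
qed

lemma openin_sets_haar:
  assumes "right_haar_measure G T M" "openin T U"
  shows "U \<in> sets M"
  using assms(2) right_haar_measureD(2)[OF assms(1)] by (simp add: sigma_sets.Basic)

text \<open>
  Some compact set has positive measure, and finitely many right translates of a nonempty open
  set cover it.
\<close>

lemma haar_measure_open_nonzero:
  assumes haar: "right_haar_measure G T M" and C: "openin T C" "c \<in> C"
  shows "emeasure M C \<noteq> 0"
proof
  assume null: "emeasure M C = 0"
  have sub: "C \<subseteq> carrier G"
    using C(1) openin_subset topspace_eq by metis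
  have "emeasure M (carrier G) = (SUP K \<in> {K. compactin T K \<and> K \<subseteq> carrier G}. emeasure M K)"
    using right_haar_measureD(5)[OF haar] openin_topspace[of T] unfolding topspace_eq by blast
  moreover have "emeasure M (carrier G) \<noteq> 0"
    by (rule right_haar_measureD(6)[OF haar])
  moreover have "emeasure M K = 0" if K: "compactin T K" for K
  proof -
    have cover: "K \<subseteq> \<Union> ((\<lambda>g. C #> g) ` carrier G)"
    proof
      fix x assume "x \<in> K"
      then have x: "x \<in> carrier G"
        using K compactin_subset_topspace topspace_eq by blast
      have c: "c \<in> carrier G"
        using C sub by auto
      have "c \<otimes> (inv c \<otimes> x) = x"
        using x c by (simp add: m_assoc[symmetric])
      then have "x \<in> C #> (inv c \<otimes> x)"
        using C(2) by (auto simp: r_coset_def intro!: bexI[of _ c])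
      moreover have "inv c \<otimes> x \<in> carrier G"
        using x c by simp
      ultimately show "x \<in> \<Union> ((\<lambda>g. C #> g) ` carrier G)"
        by (rule UN_I[rotated])
    qed
    have translates: "openin T D" if "D \<in> (\<lambda>g. C #> g) ` carrier G" for D
      using that openin_r_coset[OF C(1)] by auto
    have "\<exists>\<F>. finite \<F> \<and> \<F> \<subseteq> (\<lambda>g. C #> g) ` carrier G \<and> K \<subseteq> \<Union>\<F>"
      by (rule compactinD[OF K _ cover]) (rule translates)
    then obtain \<F> where \<F>: "finite \<F>" "\<F> \<subseteq> (\<lambda>g. C #> g) ` carrier G" "K \<subseteq> \<Union>\<F>"
      by metis
    have "D \<in> null_sets M" if "D \<in> \<F>" for D
    proof -
      have "D \<in> (\<lambda>g. C #> g) ` carrier G"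
        by (rule subsetD[OF \<F>(2) that])
      then obtain g where g: "g \<in> carrier G" "D = C #> g"
        by (elim imageE) simp
      then show ?thesis
        using null right_haar_measureD(3)[OF haar openin_sets_haar[OF haar C(1)] g(1)]
          openin_sets_haar[OF haar openin_r_coset[OF C(1) g(1)]]
        by (simp add: null_sets_def)
    qed
    then have "\<Union>\<F> \<in> null_sets M"
      using \<F>(1) by (intro null_sets.finite_Union) auto
    then have "\<Union>\<F> \<in> sets M" "emeasure M (\<Union>\<F>) = 0"
      by (simp_all add: null_sets_def)
    then show ?thesis
      using emeasure_mono[OF \<F>(3), of M] by simp
  qed
  then have "(SUP K \<in> {K. compactin T K \<and> K \<subseteq> carrier G}. emeasure M K) \<le> 0"
    by (intro SUP_least) simp
  ultimately show False
    by simp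
qed

lemma haar_measure_compact_open_pos:
  assumes haar: "right_haar_measure G T M" and C: "openin T C" "compactin T C" "c \<in> C"
  shows "measure M C > 0"
proof -
  have "emeasure M C < \<infinity>"
    by (rule right_haar_measureD(4)[OF haar C(2)])
  then show ?thesis
    using haar_measure_open_nonzero[OF haar C(1,3)]
    unfolding measure_def enn2real_positive_iff zero_less_iff_neq_zero by simp
qed


section \<open>Integrals of locally constant functions\<close>

text \<open>
  The zero set of a locally constant function is open, so the set where it does not vanish
  agrees with its closure.
\<close>

lemma hecke_algebra_support:
  assumes "f \<in> hecke_algebra G T"
  shows "continuous_map T (discrete_topology UNIV) f"
    and "compactin T {g \<in> carrier G. f g \<noteq> 0}"
proof -
  show cont: "continuous_map T (discrete_topology UNIV) f"
    unfolding continuous_map_def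
  proof (intro conjI allI impI)
    fix U :: "complex set"
    show "openin T {x \<in> topspace T. f x \<in> U}"
    proof (subst openin_subopen, intro ballI)
      fix x assume x: "x \<in> {x \<in> topspace T. f x \<in> U}"
      have "\<forall>g\<in>topspace T. \<exists>V. openin T V \<and> g \<in> V \<and> (\<forall>h\<in>V. f h = f g)"
        using assms by (simp add: hecke_algebra_def topspace_eq)
      with x obtain V where V: "openin T V" "x \<in> V" "\<forall>h\<in>V. f h = f x"
        by auto
      have "V \<subseteq> {x \<in> topspace T. f x \<in> U}"
      proof
        fix h assume h: "h \<in> V"
        have "f h = f x" "h \<in> topspace T"
          by (rule bspec[OF V(3) h], rule subsetD[OF openin_subset[OF V(1)] h])
        then show "h \<in> {x \<in> topspace T. f x \<in> U}"
          using x by simp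
      qed
      then show "\<exists>V. openin T V \<and> x \<in> V \<and> V \<subseteq> {x \<in> topspace T. f x \<in> U}"
        using V(1,2) by blast
    qed
  qed auto
  have "closedin T {g \<in> topspace T. f g \<in> - {0}}"
    by (rule closedin_continuous_map_preimage[OF cont]) simp
  then have "T closure_of {g \<in> carrier G. f g \<noteq> 0} = {g \<in> carrier G. f g \<noteq> 0}"
    by (simp add: closure_of_eq topspace_eq)
  then show "compactin T {g \<in> carrier G. f g \<noteq> 0}"
    using assms by (simp add: hecke_algebra_def)
qed

lemma indicator_in_hecke_algebra:
  assumes "openin T C" "compactin T C"
  shows "indicator C \<in> hecke_algebra G T"
proof -
  have sub: "C \<subseteq> carrier G"
    using assms(1) openin_subset topspace_eq by metis
  have clo: "closedin T C"
    using compactin_imp_closedin[OF hausdorff assms(2)] .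
  have "\<exists>U. openin T U \<and> g \<in> U \<and> (\<forall>h\<in>U. indicator C h = (indicator C g :: complex))"
    if "g \<in> carrier G" for g
  proof (cases "g \<in> C")
    case True
    then show ?thesis
      using assms(1) by (intro exI[of _ C]) auto
  next
    case False
    then show ?thesis
      using that clo by (intro exI[of _ "topspace T - C"]) (auto simp: topspace_eq[symmetric])
  qed
  moreover have "{g \<in> carrier G. indicator C g \<noteq> (0 :: complex)} = C"
    using sub by (auto simp: indicator_def)
  moreover have "T closure_of C = C"
    using clo by (simp add: closure_of_eq)
  ultimately show ?thesis
    using sub assms(2) by (auto simp: hecke_algebra_def indicator_def)
qed

text \<open>
  The function \<open>g \<mapsto> f g F g\<close> is locally constant, so its preimages are open, and its image
  of the compact support of \<open>f\<close> is compact in a discrete space, hence finite.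
\<close>

lemma simple_bochner_integrable_hecke:
  fixes F :: "'g \<Rightarrow> 'w::complex_vector"
  assumes haar: "right_haar_measure G T M" and f: "f \<in> hecke_algebra G T"
    and F: "continuous_map T (discrete_topology UNIV) F"
  shows "Bochner_Integration.simple_bochner_integrable M (\<lambda>g. f g *\<^sub>C F g)"
proof (rule simple_bochner_integrable.intros)
  let ?S = "{g \<in> carrier G. f g \<noteq> 0}"
  have space: "space M = topspace T"
    using right_haar_measureD(1)[OF haar] by (simp add: topspace_eq)
  have "continuous_map T (discrete_topology UNIV) (\<lambda>g. (f g, F g))"
    using continuous_map_pairedI[OF hecke_algebra_support(1)[OF f] F]
    by (simp add: prod_topology_discrete_topology[symmetric])
  from continuous_map_compose[OF this, of "discrete_topology UNIV" "\<lambda>(a, w). a *\<^sub>C w"]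
  have cont: "continuous_map T (discrete_topology UNIV) (\<lambda>g. f g *\<^sub>C F g)"
    by (simp add: comp_def)
  have "compactin (discrete_topology UNIV) ((\<lambda>g. f g *\<^sub>C F g) ` ?S)"
    by (rule image_compactin[OF hecke_algebra_support(2)[OF f] cont])
  then have "finite ((\<lambda>g. f g *\<^sub>C F g) ` ?S)"
    by (simp add: compactin_discrete_topology)
  moreover have "(\<lambda>g. f g *\<^sub>C F g) ` space M \<subseteq> insert 0 ((\<lambda>g. f g *\<^sub>C F g) ` ?S)"
    by (auto simp: space topspace_eq)
  ultimately have "finite ((\<lambda>g. f g *\<^sub>C F g) ` space M)"
    using finite_subset by blast
  moreover have "(\<lambda>g. f g *\<^sub>C F g) -` {y} \<inter> space M \<in> sets M" for y
    using openin_sets_haar[OF haar openin_continuous_map_preimage[OF cont, of "{y}"]]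
    by (simp add: space vimage_def Int_def conj_commute)
  ultimately show "simple_function M (\<lambda>g. f g *\<^sub>C F g)"
    by (simp add: simple_function_def)
  have "openin T {g \<in> topspace T. f g \<in> - {0}}"
    by (rule openin_continuous_map_preimage[OF hecke_algebra_support(1)[OF f]]) simp
  then have "?S \<in> sets M"
    using openin_sets_haar[OF haar] by (simp add: topspace_eq)
  then have "emeasure M {g \<in> space M. f g *\<^sub>C F g \<noteq> 0} \<le> emeasure M ?S"
    by (intro emeasure_mono) (auto simp: space topspace_eq)
  also have "\<dots> < \<infinity>"
    by (rule right_haar_measureD(4)[OF haar hecke_algebra_support(2)[OF f]])
  finally show "emeasure M {g \<in> space M. f g *\<^sub>C F g \<noteq> 0} \<noteq> \<infinity>"
    by simp
qed

lemma simple_bochner_integral_indicator: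
  fixes F :: "'g \<Rightarrow> 'w::complex_vector"
  assumes haar: "right_haar_measure G T M" and C: "openin T C" "compactin T C"
    and F: "continuous_map T (discrete_topology UNIV) F" "\<And>g. g \<in> C \<Longrightarrow> F g = w"
  shows "Bochner_Integration.simple_bochner_integral M (\<lambda>g. indicator C g *\<^sub>C F g) =
    complex_of_real (measure M C) *\<^sub>C w"
proof -
  let ?I = "indicator C :: 'g \<Rightarrow> complex"
  have sub: "C \<subseteq> space M"
    using openin_subset[OF C(1)] right_haar_measureD(1)[OF haar] by (simp add: topspace_eq)
  have "Bochner_Integration.simple_bochner_integral M (\<lambda>g. ?I g *\<^sub>C F g) =
    (\<Sum>y\<in>?I ` space M. measure M {x \<in> space M. ?I x = y} *\<^sub>R (y *\<^sub>C w))"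
  proof (rule simple_bochner_integral_partition[where v = "\<lambda>y. y *\<^sub>C w"])
    show "Bochner_Integration.simple_bochner_integrable M (\<lambda>g. ?I g *\<^sub>C F g)"
      by (rule simple_bochner_integrable_hecke[OF haar indicator_in_hecke_algebra[OF C] F(1)])
    show "simple_function M ?I"
      using openin_sets_haar[OF haar C(1)] by simp
  qed (auto simp: indicator_def F(2) split: if_splits)
  also have "\<dots> = (\<Sum>y\<in>{0, 1}. measure M {x \<in> space M. ?I x = y} *\<^sub>R (y *\<^sub>C w))"
  proof (rule sum.mono_neutral_left)
    show "\<forall>y\<in>{0, 1} - ?I ` space M. measure M {x \<in> space M. ?I x = y} *\<^sub>R (y *\<^sub>C w) = 0"
    proof
      fix y assume "y \<in> {0, 1} - ?I ` space M"
      then have "{x \<in> space M. ?I x = y} = {}"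
        by auto
      then show "measure M {x \<in> space M. ?I x = y} *\<^sub>R (y *\<^sub>C w) = 0"
        by (simp only:) simp
    qed
  qed (auto simp: indicator_def)
  also have "{x \<in> space M. ?I x = 1} = C"
    using sub by (auto simp: indicator_def)
  then have "(\<Sum>y\<in>{0, 1}. measure M {x \<in> space M. ?I x = y} *\<^sub>R (y *\<^sub>C w)) =
    complex_of_real (measure M C) *\<^sub>C w"
    by (simp add: scaleR_scaleC)
  finally show ?thesis .
qed


section \<open>Local constancy of orbit maps\<close>

text \<open>
  The right translate of a neighbourhood of the identity by \<open>g\<close> is a neighbourhood of \<open>g\<close>.  For an
  orbit map, the neighbourhood of the identity below is a stabiliser.
\<close>

lemma continuous_map_discrete_if_translates:
  assumes U: "\<And>g. g \<in> carrier G \<Longrightarrow> openin T (U g) \<and> \<one> \<in> U g"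
    and F: "\<And>g h. g \<in> carrier G \<Longrightarrow> h \<in> carrier G \<Longrightarrow> h \<otimes> inv g \<in> U g \<Longrightarrow> F h = F g"
  shows "continuous_map T (discrete_topology UNIV) F"
  unfolding continuous_map_def
proof (intro conjI allI impI)
  fix A
  show "openin T {x \<in> topspace T. F x \<in> A}"
  proof (subst openin_subopen, intro ballI)
    fix g assume g: "g \<in> {x \<in> topspace T. F x \<in> A}"
    let ?V = "{h \<in> topspace T. h \<otimes> inv g \<in> U g}"
    have "openin T ?V"
      using g U by (intro openin_continuous_map_preimage[OF continuous_map_right_translation])
        (auto simp: topspace_eq)
    moreover have "g \<in> ?V"
      using g U by (simp add: topspace_eq)
    moreover have "?V \<subseteq> {x \<in> topspace T. F x \<in> A}"
    proof
      fix h assume "h \<in> ?V"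
      then show "h \<in> {x \<in> topspace T. F x \<in> A}"
        using g F[of g h] by (simp add: topspace_eq)
    qed
    ultimately show "\<exists>V. openin T V \<and> g \<in> V \<and> V \<subseteq> {x \<in> topspace T. F x \<in> A}"
      by blast
  qed
qed auto

text \<open>If \<open>h g\<^sup>-\<^sup>1\<close> fixes \<open>s\<close>, then \<open>s.h = (s.h g\<^sup>-\<^sup>1).g = s.g\<close>.\<close>

lemma orbit_map_right_locally_constant:
  assumes "smooth_right_rep G T \<sigma>"
  shows "continuous_map T (discrete_topology UNIV) (\<sigma> s)"
proof (rule continuous_map_discrete_if_translates)
  fix g assume "g \<in> carrier G"
  show "openin T {k \<in> carrier G. \<sigma> s k = s} \<and> \<one> \<in> {k \<in> carrier G. \<sigma> s k = s}"
    using assms by (simp add: smooth_right_rep_def)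
next
  fix g h assume gh: "g \<in> carrier G" "h \<in> carrier G"
    and fixed: "h \<otimes> inv g \<in> {k \<in> carrier G. \<sigma> s k = s}"
  have "\<sigma> s h = \<sigma> s ((h \<otimes> inv g) \<otimes> g)"
    using gh by (simp add: m_assoc)
  also have "\<dots> = \<sigma> (\<sigma> s (h \<otimes> inv g)) g"
    using assms gh by (simp add: smooth_right_rep_def)
  finally show "\<sigma> s h = \<sigma> s g"
    using fixed by simp
qed

text \<open>If \<open>h g\<^sup>-\<^sup>1\<close> fixes \<open>g.v\<close>, then \<open>h.v = h g\<^sup>-\<^sup>1.(g.v) = g.v\<close>.\<close>

lemma orbit_map_left_locally_constant:
  assumes "smooth_left_rep G T \<rho>"
  shows "continuous_map T (discrete_topology UNIV) (\<lambda>g. \<rho> g v)"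
proof (rule continuous_map_discrete_if_translates)
  fix g assume "g \<in> carrier G"
  show "openin T {k \<in> carrier G. \<rho> k (\<rho> g v) = \<rho> g v} \<and> \<one> \<in> {k \<in> carrier G. \<rho> k (\<rho> g v) = \<rho> g v}"
    using assms by (simp add: smooth_left_rep_def)
next
  fix g h assume gh: "g \<in> carrier G" "h \<in> carrier G"
    and fixed: "h \<otimes> inv g \<in> {k \<in> carrier G. \<rho> k (\<rho> g v) = \<rho> g v}"
  have "\<rho> h v = \<rho> ((h \<otimes> inv g) \<otimes> g) v"
    using gh by (simp add: m_assoc)
  also have "\<dots> = \<rho> (h \<otimes> inv g) (\<rho> g v)"
    using assms gh by (simp add: smooth_left_rep_def)
  finally show "\<rho> h v = \<rho> g v"
    using fixed by simp
qed

end


section \<open>Comparison of the relations\<close>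

lemma linear_tensor_of_left: "linear (\<lambda>s. s \<otimes>\<^sub>C v)"
  by (rule linearI) (simp_all add: tensor_of_add_left tensor_of_scaleC_left scaleR_scaleC)

lemma linear_tensor_of_right: "linear (\<lambda>v. s \<otimes>\<^sub>C v)"
  by (rule linearI) (simp_all add: tensor_of_add_right tensor_of_scaleC_right scaleR_scaleC)

lemma simple_bochner_integral_in_subspace:
  fixes u :: "'a \<Rightarrow> 'w::complex_vector"
  assumes "complex_vector.subspace W" "\<And>x. x \<in> space M \<Longrightarrow> u x \<in> W"
  shows "Bochner_Integration.simple_bochner_integral M u \<in> W"
  unfolding simple_bochner_integral_def scaleR_scaleC
  using assms by (auto intro!: complex_vector.subspace_sum complex_vector.subspace_scale)

text \<open>
  Pull \<open>- \<otimes> v\<close> and \<open>s \<otimes> -\<close> into the two integrals; the difference of the integrands has the value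
  \<open>f g (s.g \<otimes> v - s \<otimes> g.v)\<close> at \<open>g\<close>.
\<close>

lemma hecke_relation_in_group_span:
  assumes "lctd_group G T" and haar: "right_haar_measure G T M"
    and "smooth_right_rep G T \<sigma>" "smooth_left_rep G T \<rho>" and f: "f \<in> hecke_algebra G T"
  shows "hecke_act_right M \<sigma> s f \<otimes>\<^sub>C v - s \<otimes>\<^sub>C hecke_act_left M \<rho> f v \<in>
    cspan {\<sigma> s g \<otimes>\<^sub>C v - s \<otimes>\<^sub>C \<rho> g v | s g v. g \<in> carrier G}" (is "_ \<in> ?N1")
proof -
  interpret lctd_group G T by fact
  let ?I = "Bochner_Integration.simple_bochner_integral M"
  let ?l = "\<lambda>g. f g *\<^sub>C \<sigma> s g" and ?r = "\<lambda>g. f g *\<^sub>C \<rho> g v"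
  have l: "Bochner_Integration.simple_bochner_integrable M ?l"
    by (rule simple_bochner_integrable_hecke[OF haar f orbit_map_right_locally_constant[OF assms(3)]])
  have r: "Bochner_Integration.simple_bochner_integrable M ?r"
    by (rule simple_bochner_integrable_hecke[OF haar f orbit_map_left_locally_constant[OF assms(4)]])
  have lv: "Bochner_Integration.simple_bochner_integrable M (\<lambda>g. ?l g \<otimes>\<^sub>C v)"
    by (rule simple_bochner_integrable_compose2[OF _ l l, of "\<lambda>x y. x \<otimes>\<^sub>C v"])
      (rule linear_0[OF linear_tensor_of_left])
  have sr: "Bochner_Integration.simple_bochner_integrable M (\<lambda>g. s \<otimes>\<^sub>C ?r g)"
    by (rule simple_bochner_integrable_compose2[OF _ r r, of "\<lambda>x y. s \<otimes>\<^sub>C x"])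
      (rule linear_0[OF linear_tensor_of_right])
  have "?I ?l \<otimes>\<^sub>C v - s \<otimes>\<^sub>C ?I ?r = ?I (\<lambda>g. ?l g \<otimes>\<^sub>C v) - ?I (\<lambda>g. s \<otimes>\<^sub>C ?r g)"
    using simple_bochner_integral_linear[OF linear_tensor_of_left[of v] l]
      simple_bochner_integral_linear[OF linear_tensor_of_right[of s] r] by simp
  also have "\<dots> = ?I (\<lambda>g. ?l g \<otimes>\<^sub>C v - s \<otimes>\<^sub>C ?r g)"
    by (rule simple_bochner_integral_diff[OF lv sr, symmetric])
  also have "\<dots> \<in> ?N1"
  proof (rule simple_bochner_integral_in_subspace)
    fix g assume "g \<in> space M"
    then have "\<sigma> s g \<otimes>\<^sub>C v - s \<otimes>\<^sub>C \<rho> g v \<in> ?N1"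
      using right_haar_measureD(1)[OF haar] by (intro complex_vector.span_base) auto
    from complex_vector.span_scale[OF this, of "f g"]
    show "?l g \<otimes>\<^sub>C v - s \<otimes>\<^sub>C ?r g \<in> ?N1"
      by (simp add: tensor_of_scaleC_left tensor_of_scaleC_right
          complex_vector.scale_right_diff_distrib)
  qed (rule complex_vector.subspace_span)
  finally show ?thesis
    by (simp add: hecke_act_left_def hecke_act_right_def)
qed

text \<open>
  Apply the Hecke relation to the indicator function of a compact open neighbourhood \<open>C\<close> of \<open>g\<close> on
  which both orbit maps are constant, and divide by the measure of \<open>C\<close>.
\<close>

lemma group_relation_in_hecke_span:
  assumes "lctd_group G T" and haar: "right_haar_measure G T M"
    and "smooth_right_rep G T \<sigma>" "smooth_left_rep G T \<rho>" and g: "g \<in> carrier G"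
  shows "\<sigma> s g \<otimes>\<^sub>C v - s \<otimes>\<^sub>C \<rho> g v \<in>
    cspan {hecke_act_right M \<sigma> s f \<otimes>\<^sub>C v - s \<otimes>\<^sub>C hecke_act_left M \<rho> f v
      | s f v. f \<in> hecke_algebra G T}" (is "_ \<in> ?N")
proof -
  interpret lctd_group G T by fact
  note orbit_r = orbit_map_right_locally_constant[OF assms(3), of s]
  note orbit_l = orbit_map_left_locally_constant[OF assms(4), of v]
  let ?W = "{h \<in> topspace T. \<sigma> s h \<in> {\<sigma> s g}} \<inter> {h \<in> topspace T. \<rho> h v \<in> {\<rho> g v}}"
  have W: "openin T ?W"
    by (intro openin_Int openin_continuous_map_preimage[OF orbit_r]
        openin_continuous_map_preimage[OF orbit_l]) auto
  have gW: "g \<in> ?W"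
    using g by (simp add: topspace_eq)
  obtain C where C: "openin T C" "compactin T C" "g \<in> C" "C \<subseteq> ?W"
    by (rule compact_open_neighbourhood[OF locally_compact hausdorff _ W gW])
      (rule totally_disconnected)
  let ?c = "complex_of_real (measure M C)"
  have "hecke_act_right M \<sigma> s (indicator C) = ?c *\<^sub>C \<sigma> s g"
    unfolding hecke_act_right_def
    by (rule simple_bochner_integral_indicator[OF haar C(1,2) orbit_r]) (use C(4) in auto)
  moreover have "hecke_act_left M \<rho> (indicator C) v = ?c *\<^sub>C \<rho> g v"
    unfolding hecke_act_left_def
    by (rule simple_bochner_integral_indicator[OF haar C(1,2) orbit_l]) (use C(4) in auto)
  moreover have "hecke_act_right M \<sigma> s (indicator C) \<otimes>\<^sub>C v -
      s \<otimes>\<^sub>C hecke_act_left M \<rho> (indicator C) v \<in> ?N"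
    using indicator_in_hecke_algebra[OF C(1,2)] by (intro complex_vector.span_base) blast
  ultimately have "?c *\<^sub>C (\<sigma> s g \<otimes>\<^sub>C v - s \<otimes>\<^sub>C \<rho> g v) \<in> ?N"
    by (simp add: tensor_of_scaleC_left tensor_of_scaleC_right
        complex_vector.scale_right_diff_distrib)
  from complex_vector.span_scale[OF this, of "inverse ?c"] show ?thesis
    using haar_measure_compact_open_pos[OF haar C(1-3)] by simp
qed

text \<open>The two sets of generators agree: replace \<open>s\<close> by \<open>s.g\<close>, respectively by \<open>s.g\<^sup>-\<^sup>1\<close>.\<close>

lemma group_relations_eq_coinvariant_relations:
  fixes G (structure)
  assumes "lctd_group G T" and rep: "smooth_right_rep G T \<sigma>"
  shows "{\<sigma> s g \<otimes>\<^sub>C v - s \<otimes>\<^sub>C \<rho> g v | s g v. g \<in> carrier G} =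
    {s \<otimes>\<^sub>C v - \<sigma> s (inv g) \<otimes>\<^sub>C \<rho> g v | s g v. g \<in> carrier G}" (is "?A = ?B")
proof -
  interpret lctd_group G T by fact
  have cancel: "\<sigma> (\<sigma> s g) (inv g) = s" "\<sigma> (\<sigma> s (inv g)) g = s" if g: "g \<in> carrier G" for s g
  proof -
    have one: "\<sigma> s \<one> = s"
      and mult: "h \<in> carrier G \<Longrightarrow> k \<in> carrier G \<Longrightarrow> \<sigma> (\<sigma> s h) k = \<sigma> s (h \<otimes> k)" for h k
      using rep by (simp_all add: smooth_right_rep_def)
    show "\<sigma> (\<sigma> s g) (inv g) = s" "\<sigma> (\<sigma> s (inv g)) g = s"
      using g by (simp_all add: mult one)
  qed
  show ?thesis
  proof (intro equalityI subsetI)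
    fix x assume "x \<in> ?A"
    then obtain s g v where x: "x = \<sigma> s g \<otimes>\<^sub>C v - s \<otimes>\<^sub>C \<rho> g v" and g: "g \<in> carrier G"
      by blast
    have "x = \<sigma> s g \<otimes>\<^sub>C v - \<sigma> (\<sigma> s g) (inv g) \<otimes>\<^sub>C \<rho> g v"
      by (simp add: x cancel g)
    then show "x \<in> ?B"
      using g by blast
  next
    fix x assume "x \<in> ?B"
    then obtain s g v where x: "x = s \<otimes>\<^sub>C v - \<sigma> s (inv g) \<otimes>\<^sub>C \<rho> g v" and g: "g \<in> carrier G"
      by blast
    have "x = \<sigma> (\<sigma> s (inv g)) g \<otimes>\<^sub>C v - \<sigma> s (inv g) \<otimes>\<^sub>C \<rho> g v"
      by (simp add: x cancel g)
    then show "x \<in> ?A"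
      using g by blast
  qed
qed

theorem lemma2p4:
  fixes G :: "('g, 'b) monoid_scheme"
    and T :: "'g topology"
    and M :: "'g measure"
    and \<sigma> :: "'s::complex_vector \<Rightarrow> 'g \<Rightarrow> 's"
    and \<rho> :: "'g \<Rightarrow> 'v::complex_vector \<Rightarrow> 'v"
  assumes "lctd_group G T"
    and "right_haar_measure G T M"
    and "smooth_right_rep G T \<sigma>"
    and "smooth_left_rep G T \<rho>"
  shows "hecke_tensor G T M \<sigma> \<rho> = group_tensor G \<sigma> \<rho> \<and>
         group_tensor G \<sigma> \<rho> = tensor_coinvariants G \<sigma> \<rho>"
proof
  have "cspan {hecke_act_right M \<sigma> s f \<otimes>\<^sub>C v - s \<otimes>\<^sub>C hecke_act_left M \<rho> f v
      | s f v. f \<in> hecke_algebra G T} =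
    cspan {\<sigma> s g \<otimes>\<^sub>C v - s \<otimes>\<^sub>C \<rho> g v | s g v. g \<in> carrier G}"
    unfolding complex_vector.span_eq
    by (intro conjI subsetI; elim CollectE exE conjE; simp only:)
      (rule hecke_relation_in_group_span[OF assms] group_relation_in_hecke_span[OF assms],
        assumption)+
  then show "hecke_tensor G T M \<sigma> \<rho> = group_tensor G \<sigma> \<rho>"
    by (simp add: hecke_tensor_def group_tensor_def)
  show "group_tensor G \<sigma> \<rho> = tensor_coinvariants G \<sigma> \<rho>"
    unfolding group_tensor_def tensor_coinvariants_def
    by (simp only: group_relations_eq_coinvariant_relations[OF assms(1,3)])
qed

end
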